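(* Let $I\subseteq\overline{\mathbb R}[x_1,\dots,x_n]$ be a tropical ideal. For any $a\in\overline{\mathbb R}$, the ideal $I|_{x_n=a}:=\{f(x_1,\dots,x_{n-1},a):f\in I\}\subseteq\overline{\mathbb R}[x_1,\dots,x_{n-1}]$ is also a tropical ideal.
   Context: $\overline{\mathbb R}=(\mathbb R\cup\{\infty\},\oplus,\odot)$ with $a\oplus b=\min(a,b)$, $a\odot b=a+b$ (so $\infty$ is the additive identity and $0$ the multiplicative identity; substituting $a=\infty$ kills all terms involving $x_n$). For a polynomial $f$, $[f]_{\mathbf x^{\mathbf u}}$ denotes the coefficient of the monomial $\mathbf x^{\mathbf u}$. An ideal $I$ is a tropical ideal if for all $f,g\in I$ and every monomial $\mathbf x^{\mathbf u}$ with $[f]_{\mathbf x^{\mathbf u}}=[g]_{\mathbf x^{\mathbf u}}\neq\infty$ there exists $h\in I$ with $[h]_{\mathbf x^{\mathbf u}}=\infty$ and $[h]_{\mathbf x^{\mathbf v}}\ge\min([f]_{\mathbf x^{\mathbf v}},[g]_{\mathbf x^{\mathbf v}})$ for all monomials $\mathbf x^{\mathbf v}$, with equality whenever $[f]_{\mathbf x^{\mathbf v}}\ne[g]_{\mathbf x^{\mathbf v}}$. *)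

theory Defs
  imports Complex_Main
begin

datatype trop = Fin real | Infty

instantiation trop :: linorder
begin
fun less_eq_trop :: "trop \<Rightarrow> trop \<Rightarrow> bool" where
  "less_eq_trop (Fin x) (Fin y) = (x \<le> y)"
| "less_eq_trop _ Infty = True"
| "less_eq_trop Infty (Fin _) = False"
definition less_trop :: "trop \<Rightarrow> trop \<Rightarrow> bool" where
  "less_trop a b = (a \<le> b \<and> \<not> b \<le> a)"
instance
proof
  fix x y z :: trop
  show "(x < y) = (x \<le> y \<and> \<not> y \<le> x)" by (simp add: less_trop_def)
  show "x \<le> x" by (cases x) auto
  show "x \<le> y \<Longrightarrow> y \<le> z \<Longrightarrow> x \<le> z" by (cases x; cases y; cases z) auto
  show "x \<le> y \<Longrightarrow> y \<le> x \<Longrightarrow> x = y" by (cases x; cases y) auto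
  show "x \<le> y \<or> y \<le> x" by (cases x; cases y) auto
qed
end

instantiation trop :: comm_monoid_add
begin
definition zero_trop :: trop where "zero_trop = Infty"
definition plus_trop :: "trop \<Rightarrow> trop \<Rightarrow> trop" where "plus_trop a b = min a b"
instance
proof
  fix a b c :: trop
  show "a + b + c = a + (b + c)" by (simp add: plus_trop_def min.assoc)
  show "a + b = b + a" by (simp add: plus_trop_def min.commute)
  show "0 + a = a" by (cases a) (auto simp: plus_trop_def zero_trop_def min_def)
qed
end

fun tmul :: "trop \<Rightarrow> trop \<Rightarrow> trop" where
  "tmul (Fin x) (Fin y) = Fin (x + y)"
| "tmul _ _ = Infty"

text \<open>Tropical power a^{\<odot>k}; a^{\<odot>0} = 0 (the tropical one) also for a = Infty.\<close>
fun tpow :: "trop \<Rightarrow> nat \<Rightarrow> trop" where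
  "tpow a 0 = Fin 0"
| "tpow (Fin x) k = Fin (real k * x)"
| "tpow Infty (Suc _) = Infty"

text \<open>A tropical polynomial in n variables x_1..x_n: a map from exponent vectors
  (lists of length n) to coefficients, with finite support; coefficient Infty means
  the monomial is absent.\<close>
type_synonym tpoly = "nat list \<Rightarrow> trop"

definition is_tpoly :: "nat \<Rightarrow> tpoly \<Rightarrow> bool" where
  "is_tpoly n f \<longleftrightarrow> finite {u. f u \<noteq> Infty} \<and> (\<forall>u. f u \<noteq> Infty \<longrightarrow> length u = n)"

definition padd :: "tpoly \<Rightarrow> tpoly \<Rightarrow> tpoly" where
  "padd f g = (\<lambda>u. f u + g u)"

definition pmul :: "tpoly \<Rightarrow> tpoly \<Rightarrow> tpoly" where
  "pmul f g = (\<lambda>w. \<Sum>(u, v) \<in> {(u, v). length u = length w \<and> length v = length w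
        \<and> map2 (+) u v = w \<and> f u \<noteq> Infty \<and> g v \<noteq> Infty}. tmul (f u) (g v))"

definition tideal :: "nat \<Rightarrow> tpoly set \<Rightarrow> bool" where
  "tideal n I \<longleftrightarrow> I \<subseteq> {f. is_tpoly n f} \<and> (\<lambda>_. Infty) \<in> I
     \<and> (\<forall>f\<in>I. \<forall>g\<in>I. padd f g \<in> I)
     \<and> (\<forall>f\<in>I. \<forall>h. is_tpoly n h \<longrightarrow> pmul h f \<in> I)"

definition tropical_ideal :: "nat \<Rightarrow> tpoly set \<Rightarrow> bool" where
  "tropical_ideal n I \<longleftrightarrow> tideal n I \<and>
     (\<forall>f\<in>I. \<forall>g\<in>I. \<forall>u. f u = g u \<and> f u \<noteq> Infty \<longrightarrow>
        (\<exists>h\<in>I. h u = Infty \<and>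
           (\<forall>v. h v \<ge> min (f v) (g v) \<and> (f v \<noteq> g v \<longrightarrow> h v = min (f v) (g v)))))"

definition subst_last :: "trop \<Rightarrow> tpoly \<Rightarrow> tpoly" where
  "subst_last a f = (\<lambda>w. \<Sum>k \<in> {k. f (w @ [k]) \<noteq> Infty}. tmul (f (w @ [k])) (tpow a k))"

end

theory Submission
  imports Defs
begin

text \<open>For finite \<open>a\<close>, let \<open>f, g \<in> I\<close> have specialisations \<open>F, G\<close> with \<open>F u = G u\<close>; addition
  of polynomials reduces the claim to preserving one coordinate \<open>v\<close> with \<open>F v < G v\<close>. All
  monomials over \<open>u\<close> must be eliminated at once. If their degrees in the last variable are at
  most \<open>D\<close>, the multiples of \<open>f\<close> and \<open>g\<close> by the powers \<open>0, \<dots>, D\<close> of the last variable involve only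
  \<open>2 D + 1\<close> monomials over \<open>u\<close>, but these \<open>2 D + 2\<close> polynomials are in echelon form with respect
  to the lowest monomials over \<open>v\<close> (for \<open>f\<close>) and over \<open>u\<close> (for \<open>g\<close>) at which the minimum is
  attained. A valuated Gaussian elimination therefore leaves one polynomial with no monomial
  over \<open>u\<close>, and its pivot must lie over \<open>v\<close>.\<close>

section \<open>Order and arithmetic of the min-plus semiring\<close>

lemma le_Infty [simp]: "x \<le> Infty"
  by (cases x) auto

lemma Infty_le_iff [simp]: "Infty \<le> x \<longleftrightarrow> x = Infty"
  by (cases x) auto

lemma less_Infty_iff [simp]: "x < Infty \<longleftrightarrow> x \<noteq> Infty"
  by (cases x) (auto simp: less_trop_def)

lemma not_Infty_less [simp]: "\<not> Infty < x"
  by (simp add: not_less)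

lemma Fin_less_Fin [simp]: "Fin x < Fin y \<longleftrightarrow> x < y"
  by (auto simp: less_trop_def)

lemma tmul_Infty [simp]: "tmul x Infty = Infty" "tmul Infty x = Infty"
  by (cases x; simp)+

lemma tmul_eq_Infty_iff [simp]: "tmul x y = Infty \<longleftrightarrow> x = Infty \<or> y = Infty"
  by (cases x; cases y) auto

lemma tmul_assoc: "tmul (tmul x y) z = tmul x (tmul y z)"
  by (cases x; cases y; cases z) auto

lemma tmul_commute: "tmul x y = tmul y x"
  by (cases x; cases y) auto

lemma tmul_Fin_0 [simp]: "tmul (Fin 0) x = x" "tmul x (Fin 0) = x"
  by (cases x; simp)+

lemma tmul_min_right: "tmul x (min y z) = min (tmul x y) (tmul x z)"
  by (cases x; cases y; cases z) (auto simp: min_def)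

lemma tmul_Fin_le_iff [simp]: "tmul x (Fin c) \<le> tmul y (Fin c) \<longleftrightarrow> x \<le> y"
  by (cases x; cases y) auto

lemma tmul_Fin_less_iff [simp]: "tmul x (Fin c) < tmul y (Fin c) \<longleftrightarrow> x < y"
  by (cases x; cases y) auto

lemma tmul_Fin_eq_iff [simp]: "tmul x (Fin c) = tmul y (Fin c) \<longleftrightarrow> x = y"
  by (cases x; cases y) auto

lemma tpow_Fin [simp]: "tpow (Fin x) k = Fin (real k * x)"
  by (cases k) auto

lemma le_tmul_Fin: "b \<le> x \<Longrightarrow> 0 \<le> c \<Longrightarrow> b \<le> tmul (Fin c) x"
  by (cases b; cases x) auto

lemma less_tmul_Fin: "b < x \<Longrightarrow> 0 \<le> c \<Longrightarrow> b < tmul (Fin c) x"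
  by (cases b; cases x) auto

lemma le_less_tmul_Fin: "b \<le> x \<Longrightarrow> 0 < c \<Longrightarrow> b \<noteq> Infty \<Longrightarrow> b < tmul (Fin c) x"
  by (cases b; cases x) auto

lemma le_plus_trop_iff [simp]: "(c :: trop) \<le> a + b \<longleftrightarrow> c \<le> a \<and> c \<le> b"
  by (simp add: plus_trop_def)

lemma le_sum_trop_iff:
  fixes c :: trop
  assumes "finite A"
  shows "c \<le> sum f A \<longleftrightarrow> (\<forall>x\<in>A. c \<le> f x)"
  using assms by induction (auto simp: zero_trop_def)

lemma sum_trop_attained:
  fixes f :: "'a \<Rightarrow> trop"
  assumes "finite A" "sum f A \<noteq> Infty"
  shows "\<exists>x\<in>A. sum f A = f x"
  using assms
proof induction
  case (insert x A)
  then show ?case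
    by (cases "f x \<le> sum f A") (auto simp: plus_trop_def min_def)
qed (simp add: zero_trop_def)

lemma tmul_sum_right:
  assumes "finite A"
  shows "tmul x (sum f A) = (\<Sum>y\<in>A. tmul x (f y))"
  using assms
  by induction (auto simp: zero_trop_def plus_trop_def tmul_min_right)

text \<open>Sums are finite minima, so a lower bound on a sum is a universally quantified statement
  about its terms. Testing equality by lower bounds turns identities between polynomials into pure
  logic.\<close>

lemma eq_by_lower_bounds: "(\<And>c. c \<le> x \<longleftrightarrow> c \<le> y) \<Longrightarrow> x = (y :: trop)"
  by (meson order_antisym order_refl)

section \<open>Valuated Gaussian elimination\<close>

text \<open>The structure that Gaussian elimination uses: the vector elimination axiom of valuated
  matroids together with finite scaling, over an arbitrary index set. Sums are not asked
  for.\<close>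

definition elim_closed :: "('b \<Rightarrow> trop) set \<Rightarrow> bool" where
  "elim_closed L \<longleftrightarrow>
     (\<forall>f\<in>L. \<forall>c. (\<lambda>x. tmul (Fin c) (f x)) \<in> L) \<and>
     (\<forall>f\<in>L. \<forall>g\<in>L. \<forall>u. f u = g u \<and> f u \<noteq> Infty \<longrightarrow>
        (\<exists>h\<in>L. h u = Infty \<and>
           (\<forall>v. h v \<ge> min (f v) (g v) \<and> (f v \<noteq> g v \<longrightarrow> h v = min (f v) (g v)))))"

lemma elim_closedE:
  assumes "elim_closed L" "f \<in> L" "g \<in> L" "f u = g u" "f u \<noteq> Infty"
  obtains h where "h \<in> L" "h u = Infty" "\<And>v. h v \<ge> min (f v) (g v)"
    "\<And>v. f v \<noteq> g v \<Longrightarrow> h v = min (f v) (g v)"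
proof -
  have "\<exists>h\<in>L. h u = Infty \<and>
      (\<forall>v. h v \<ge> min (f v) (g v) \<and> (f v \<noteq> g v \<longrightarrow> h v = min (f v) (g v)))"
    by (rule assms(1)[unfolded elim_closed_def, THEN conjunct2, THEN bspec, OF assms(2),
          THEN bspec, OF assms(3), THEN spec, THEN mp, OF conjI[OF assms(4,5)]])
  then show thesis using that by blast
qed

lemma elim_closed_scale: "elim_closed L \<Longrightarrow> f \<in> L \<Longrightarrow> (\<lambda>x. tmul (Fin c) (f x)) \<in> L"
  by (simp add: elim_closed_def)

text \<open>The result of an elimination is bounded below by the minimum of its two inputs, so a
  common value \<open>Infty\<close> is inherited. This lets coordinates be eliminated one after
  another.\<close>

lemma elim_closed_vanishing:
  assumes "elim_closed L"
  shows "elim_closed {f \<in> L. \<forall>x\<in>X. f x = Infty}"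
  unfolding elim_closed_def
proof (intro conjI ballI allI impI; (elim conjE)?)
  fix f c assume "f \<in> {f \<in> L. \<forall>x\<in>X. f x = Infty}"
  then show "(\<lambda>x. tmul (Fin c) (f x)) \<in> {f \<in> L. \<forall>x\<in>X. f x = Infty}"
    using assms by (auto simp: elim_closed_def)
next
  fix f g u
  assume f: "f \<in> {f \<in> L. \<forall>x\<in>X. f x = Infty}" and g: "g \<in> {f \<in> L. \<forall>x\<in>X. f x = Infty}"
    and u: "f u = g u" "f u \<noteq> Infty"
  then obtain h where h: "h \<in> L" "h u = Infty"
    "\<And>v. h v \<ge> min (f v) (g v)" "\<And>v. f v \<noteq> g v \<Longrightarrow> h v = min (f v) (g v)"
    using elim_closedE[OF assms, of f g u] by blast
  have "h x = Infty" if "x \<in> X" for x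
    using h(3)[of x] f g that by simp
  with h show "\<exists>h\<in>{f \<in> L. \<forall>x\<in>X. f x = Infty}. h u = Infty \<and>
      (\<forall>v. h v \<ge> min (f v) (g v) \<and> (f v \<noteq> g v \<longrightarrow> h v = min (f v) (g v)))"
    by blast
qed

text \<open>Relative to the bound \<open>B\<close>, the coordinates where a vector attains \<open>B\<close> play the role of
  its support modulo the maximal ideal of a valuation ring; the hypotheses say that the family
  \<open>w\<close> is in echelon form there, with pivots \<open>l\<close>. Each elimination step uses up one vector: the
  one of least value at \<open>s\<close> and, among those, of greatest index, so that the scaling factors
  are nonnegative and the echelon form survives.\<close>

lemma eliminate_from_echelon_family:
  fixes w :: "'i :: linorder \<Rightarrow> 'b \<Rightarrow> trop"
  assumes "finite S" "elim_closed L" "finite J" "card S < card J"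
    and "\<And>j. j \<in> J \<Longrightarrow> w j \<in> L"
    and "\<And>j x. j \<in> J \<Longrightarrow> B x \<le> w j x"
    and "\<And>j. j \<in> J \<Longrightarrow> w j (l j) = B (l j)"
    and "\<And>j. j \<in> J \<Longrightarrow> B (l j) \<noteq> Infty"
    and "\<And>i j. i \<in> J \<Longrightarrow> j \<in> J \<Longrightarrow> i < j \<Longrightarrow> B (l i) < w j (l i)"
  shows "\<exists>h\<in>L. (\<forall>s\<in>S. h s = Infty) \<and> (\<forall>x. B x \<le> h x) \<and> (\<exists>j\<in>J. h (l j) = B (l j))"
  using assms
proof (induction S arbitrary: L J w rule: finite_induct)
  case empty
  then have "J \<noteq> {}" by auto
  with empty show ?case by blast
next
  case (insert s S)
  note L = insert.prems(1) and J = insert.prems(2) and w = insert.prems(4-8)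
  define m where "m = Min ((\<lambda>j. w j s) ` J)"
  have "J \<noteq> {}" using insert.prems(3) by auto
  then have m_in: "m \<in> (\<lambda>j. w j s) ` J" unfolding m_def using J by (intro Min_in) auto
  have m_le: "m \<le> w j s" if "j \<in> J" for j unfolding m_def using J that by auto
  define p where "p = Max {j\<in>J. w j s = m}"
  have "p \<in> {j\<in>J. w j s = m}"
    unfolding p_def using J m_in by (intro Max_in) auto
  then have p: "p \<in> J" "w p s = m" by auto
  have p_max: "j \<le> p" if "j \<in> J" "w j s = m" for j
    unfolding p_def using J that by auto
  \<comment> \<open>The demands on the replacement of \<open>w i\<close>: absent at
    \<open>s\<close>, and such that the new family over \<open>J - {p}\<close> is again in echelon
    form with the old pivots.\<close>
  let ?P = "\<lambda>i h. h \<in> L \<and> h s = Infty \<and> (\<forall>x. B x \<le> h x) \<and> h (l i) = B (l i) \<and>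
      (\<forall>k\<in>J - {p}. k < i \<longrightarrow> B (l k) < h (l k))"
  have "\<exists>h. ?P i h" if i: "i \<in> J - {p}" for i
  proof (cases "w i s = Infty")
    case True
    with i w show ?thesis by (intro exI[of _ "w i"]) auto
  next
    case False
    then obtain y where y: "w i s = Fin y" by (cases "w i s") auto
    with m_le[of i] i obtain z where z: "m = Fin z" by (cases m) auto
    \<comment> \<open>Scaling \<open>w p\<close> by \<open>c\<close> makes it agree with
      \<open>w i\<close> at \<open>s\<close>. Minimality of \<open>m\<close> gives
      \<open>0 \<le> c\<close>, so the bound \<open>B\<close> survives.\<close>
    define c where "c = y - z"
    have c: "0 \<le> c" using m_le[of i] i y z by (auto simp: c_def)
    have c_pos: "0 < c" if "p < i"
    proof -
      have "w i s \<noteq> m" using p_max[of i] i that by auto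
      with c y z show ?thesis by (auto simp: c_def)
    qed
    let ?g = "\<lambda>x. tmul (Fin c) (w p x)"
    have "?g \<in> L" using L w(1)[OF p(1)] by (rule elim_closed_scale)
    moreover have "w i s = ?g s" using y z p(2) by (simp add: c_def)
    ultimately obtain h where h: "h \<in> L" "h s = Infty"
      "\<And>v. h v \<ge> min (w i v) (?g v)" "\<And>v. w i v \<noteq> ?g v \<Longrightarrow> h v = min (w i v) (?g v)"
      using elim_closedE[OF L w(1)[of i], of ?g s] i False by blast
    \<comment> \<open>For \<open>k < p\<close> strictness is the echelon condition on
      \<open>w p\<close>. For \<open>k > p\<close> also \<open>i > p\<close>, and the maximal choice
      of \<open>p\<close> forces \<open>c > 0\<close>. Hence the scaled vector disturbs neither the
      pivot of \<open>w i\<close> nor the strict entries at earlier pivots.\<close>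
    have g_gt: "B (l k) < ?g (l k)" if "k \<in> J - {p}" "k \<le> i" for k
    proof (cases "k < p")
      case True
      then show ?thesis using that w(5)[of k p] p(1) c by (auto intro: less_tmul_Fin)
    next
      case False
      with that have "p < i" by auto
      then show ?thesis using that w(2,4) p(1) c_pos by (auto intro: le_less_tmul_Fin)
    qed
    have "B x \<le> h x" for x
      using h(3)[of x] w(2)[of i x] le_tmul_Fin[OF w(2)[OF p(1)] c, of x] i
      by (auto simp: min_def split: if_splits)
    moreover have "h (l i) = B (l i)"
      using g_gt[of i] h(4)[of "l i"] w(3)[of i] i by (auto simp: min_def)
    moreover have "B (l k) < h (l k)" if "k \<in> J - {p}" "k < i" for k
    proof -
      have "B (l k) < min (w i (l k)) (?g (l k))"
        using g_gt[of k] that w(5)[of k i] i by simp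
      then show ?thesis using h(3) by (rule less_le_trans)
    qed
    ultimately show ?thesis using h by blast
  qed
  then obtain w' where w': "\<And>i. i \<in> J - {p} \<Longrightarrow> ?P i (w' i)" by metis
  \<comment> \<open>Continuing inside the vectors absent at \<open>s\<close> keeps later
    eliminations from reintroducing \<open>s\<close>.\<close>
  let ?L = "{f \<in> L. \<forall>x\<in>{s}. f x = Infty}"
  have "\<exists>h\<in>?L. (\<forall>s\<in>S. h s = Infty) \<and> (\<forall>x. B x \<le> h x) \<and> (\<exists>j\<in>J - {p}. h (l j) = B (l j))"
  proof (rule insert.IH[where w = w'])
    show "elim_closed ?L" using L by (rule elim_closed_vanishing)
    show "card S < card (J - {p})" using insert.prems(3) insert.hyps p(1) J by simp
  qed (use J w' w in auto)
  then show ?case by auto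
qed

section \<open>Tropical polynomials\<close>

lemma finite_last_coords:
  assumes "is_tpoly n f"
  shows "finite {k. f (w @ [k]) \<noteq> Infty}"
proof -
  have "finite ((\<lambda>k. w @ [k]) -` {u. f u \<noteq> Infty})"
    using assms by (intro finite_vimageI) (auto simp: is_tpoly_def inj_def)
  then show ?thesis by (simp add: vimage_def)
qed

text \<open>Absent monomials contribute \<open>Infty\<close>, so \<open>k\<close> may range over all
  natural numbers.\<close>

lemma le_subst_last_iff:
  assumes "is_tpoly n f"
  shows "c \<le> subst_last a f w \<longleftrightarrow> (\<forall>k. c \<le> tmul (f (w @ [k])) (tpow a k))"
  unfolding subst_last_def le_sum_trop_iff[OF finite_last_coords[OF assms]]
  by auto (metis le_Infty tmul_Infty(2))

lemma subst_last_le: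
  assumes "is_tpoly n f"
  shows "subst_last a f w \<le> tmul (f (w @ [k])) (tpow a k)"
  using le_subst_last_iff[OF assms, of "subst_last a f w" a w] by simp

lemma subst_last_attained:
  assumes "is_tpoly n f" "subst_last a f w \<noteq> Infty"
  shows "\<exists>k. subst_last a f w = tmul (f (w @ [k])) (tpow a k)"
  using sum_trop_attained[OF finite_last_coords[OF assms(1)]] assms(2)
  unfolding subst_last_def by blast

lemma subst_last_eq_Infty:
  assumes "\<And>k. f (w @ [k]) = Infty"
  shows "subst_last a f w = Infty"
  using assms by (simp add: subst_last_def zero_trop_def)

text \<open>Only the zeroth power survives, since \<open>tpow Infty 0\<close> is the tropical
  one.\<close>

lemma subst_last_Infty:
  assumes "is_tpoly n f"
  shows "subst_last Infty f w = f (w @ [0])"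
proof (rule eq_by_lower_bounds)
  fix c
  have "(\<forall>k. c \<le> tmul (f (w @ [k])) (tpow Infty k)) \<longleftrightarrow> c \<le> f (w @ [0])"
    by (metis le_Infty tmul_Fin_0(2) tmul_Infty(1) tpow.simps(1,3) not0_implies_Suc)
  then show "c \<le> subst_last Infty f w \<longleftrightarrow> c \<le> f (w @ [0])"
    by (simp add: le_subst_last_iff[OF assms])
qed

lemma is_tpoly_subst_last:
  assumes "is_tpoly (Suc n) f"
  shows "is_tpoly n (subst_last a f)"
proof -
  have ex: "\<exists>k. f (w @ [k]) \<noteq> Infty" if "subst_last a f w \<noteq> Infty" for w
    using that subst_last_eq_Infty by blast
  then have "{w. subst_last a f w \<noteq> Infty} \<subseteq> butlast ` {u. f u \<noteq> Infty}"
    by (force simp: image_iff)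
  then show ?thesis
    using assms ex unfolding is_tpoly_def
    by (metis (no_types, lifting) finite_imageI finite_subset length_append_singleton nat.inject)
qed

section \<open>Products of tropical polynomials and monomials\<close>

lemma finite_pmul_index:
  assumes "is_tpoly n f" "is_tpoly m g"
  shows "finite {(u, v). length u = length w \<and> length v = length w
        \<and> map2 (+) u v = w \<and> f u \<noteq> Infty \<and> g v \<noteq> Infty}"
  by (rule finite_subset[of _ "{u. f u \<noteq> Infty} \<times> {u. g u \<noteq> Infty}"])
     (use assms in \<open>auto simp: is_tpoly_def\<close>)

text \<open>The factor \<open>t\<close> is carried along because substitution weights each
  coefficient of a product by a power of \<open>a\<close>; \<open>t = Fin 0\<close> gives the plain
  product.\<close>

lemma le_tmul_pmul_iff:
  assumes "is_tpoly n f" "is_tpoly m g"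
  shows "c \<le> tmul t (pmul f g w) \<longleftrightarrow> (\<forall>u v. length u = length w \<and> length v = length w
        \<and> map2 (+) u v = w \<longrightarrow> c \<le> tmul t (tmul (f u) (g v)))"
proof -
  have "f u \<noteq> Infty \<and> g v \<noteq> Infty" if "\<not> c \<le> tmul t (tmul (f u) (g v))" for u v
    using that by auto
  then show ?thesis
    unfolding pmul_def tmul_sum_right[OF finite_pmul_index[OF assms]]
      le_sum_trop_iff[OF finite_pmul_index[OF assms]]
      Ball_def split_paired_All mem_Collect_eq prod.case
    by (intro iff_allI) meson
qed

lemmas le_pmul_iff = le_tmul_pmul_iff[where t = "Fin 0", unfolded tmul_Fin_0]

definition tmonom :: "trop \<Rightarrow> nat list \<Rightarrow> tpoly" where
  "tmonom c e = (\<lambda>u. if u = e then c else Infty)"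

lemma is_tpoly_tmonom [simp]: "is_tpoly (length e) (tmonom c e)"
  unfolding is_tpoly_def tmonom_def by (auto intro: finite_subset[of _ "{e}"])

lemma le_pmul_tmonom_iff:
  assumes "is_tpoly n f"
  shows "c \<le> pmul (tmonom d e) f w \<longleftrightarrow>
    (\<forall>v. length e = length w \<and> length v = length w \<and> map2 (+) e v = w \<longrightarrow> c \<le> tmul d (f v))"
  unfolding le_pmul_iff[OF is_tpoly_tmonom assms] by (auto simp: tmonom_def)

lemma map2_plus_zeros_iff:
  "length v = n \<Longrightarrow> map2 (+) (replicate n 0) v = w \<longleftrightarrow> v = (w :: nat list)"
proof -
  have "map2 (+) (replicate (length v) 0) v = v" for v :: "nat list"
    by (induction v) auto
  then show "length v = n \<Longrightarrow> ?thesis" by metis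
qed

lemma pmul_const:
  assumes "is_tpoly n f"
  shows "pmul (tmonom d (replicate n 0)) f = (\<lambda>w. tmul d (f w))"
proof (intro ext eq_by_lower_bounds)
  fix w c
  show "c \<le> pmul (tmonom d (replicate n 0)) f w \<longleftrightarrow> c \<le> tmul d (f w)"
  proof (cases "length w = n")
    case True
    then have "length (replicate n (0 :: nat)) = length w \<and> length v = length w \<and>
        map2 (+) (replicate n 0) v = w \<longleftrightarrow> v = w" for v
      using map2_plus_zeros_iff[of v n w] by auto
    then show ?thesis
      unfolding le_pmul_tmonom_iff[OF assms] by simp
  next
    case False
    then have "f w = Infty" using assms by (auto simp: is_tpoly_def)
    then show ?thesis using False by (simp add: le_pmul_tmonom_iff[OF assms])
  qed
qed

lemma pmul_last_power:
  assumes "is_tpoly (Suc n) f"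
  shows "pmul (tmonom d (replicate n 0 @ [i])) f (w @ [k]) =
    (if i \<le> k then tmul d (f (w @ [k - i])) else Infty)"
proof (rule eq_by_lower_bounds)
  fix c
  have *: "length v = Suc n \<and> map2 (+) (replicate n 0 @ [i]) v = w @ [k] \<longleftrightarrow>
      i \<le> k \<and> v = w @ [k - i]" if "length w = n" for v
  proof (cases v rule: rev_cases)
    case (snoc v' j)
    then show ?thesis using that
      by (auto simp: map2_plus_zeros_iff)
  qed auto
  show "c \<le> pmul (tmonom d (replicate n 0 @ [i])) f (w @ [k]) \<longleftrightarrow>
      c \<le> (if i \<le> k then tmul d (f (w @ [k - i])) else Infty)"
  proof (cases "length w = n")
    case True
    then show ?thesis using *
      by (auto simp: le_pmul_tmonom_iff[OF assms])
  next
    case False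
    then have "f (w @ [k - i]) = Infty" using assms by (auto simp: is_tpoly_def)
    then show ?thesis using False by (auto simp: le_pmul_tmonom_iff[OF assms])
  qed
qed

lemma tideal_is_tpoly: "tideal n I \<Longrightarrow> f \<in> I \<Longrightarrow> is_tpoly n f"
  by (auto simp: tideal_def)

text \<open>Scaling is multiplication by a constant polynomial.\<close>

lemma elim_closed_tropical_ideal:
  assumes "tropical_ideal n I"
  shows "elim_closed I"
  unfolding elim_closed_def
proof (intro conjI)
  show "\<forall>f\<in>I. \<forall>c. (\<lambda>x. tmul (Fin c) (f x)) \<in> I"
  proof (intro ballI allI)
    fix f c assume f: "f \<in> I"
    have "tideal n I" using assms by (simp add: tropical_ideal_def)
    then have "is_tpoly n f" "pmul (tmonom (Fin c) (replicate n 0)) f \<in> I"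
      using f is_tpoly_tmonom[of "replicate n 0"] by (auto simp: tideal_def)
    then show "(\<lambda>x. tmul (Fin c) (f x)) \<in> I" by (simp add: pmul_const)
  qed
qed (rule conjunct2[OF assms[unfolded tropical_ideal_def]])

section \<open>Substitution\<close>

lemma subst_last_padd:
  assumes "is_tpoly n f" "is_tpoly n g"
  shows "subst_last a (padd f g) = padd (subst_last a f) (subst_last a g)"
proof (intro ext eq_by_lower_bounds)
  fix w c
  have "is_tpoly n (padd f g)"
  proof -
    have *: "f u \<noteq> Infty \<or> g u \<noteq> Infty" if "padd f g u \<noteq> Infty" for u
      using that by (auto simp: padd_def plus_trop_def)
    then have "finite {u. padd f g u \<noteq> Infty}"
      using assms
      by (auto simp: is_tpoly_def
          intro: finite_subset[of _ "{u. f u \<noteq> Infty} \<union> {u. g u \<noteq> Infty}"])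
    moreover have "length u = n" if "padd f g u \<noteq> Infty" for u
      using *[OF that] assms by (auto simp: is_tpoly_def)
    ultimately show ?thesis by (simp add: is_tpoly_def)
  qed
  moreover have "tmul (x + y) z = tmul x z + tmul y z" for x y z
    by (metis plus_trop_def tmul_commute tmul_min_right)
  ultimately show "c \<le> subst_last a (padd f g) w \<longleftrightarrow> c \<le> padd (subst_last a f) (subst_last a g) w"
    using assms by (auto simp: le_subst_last_iff padd_def)
qed

text \<open>The inclusion of the polynomials in one variable fewer. It lifts multiplication in the
  image of the substitution back to \<open>I\<close>.\<close>

definition const_in_last :: "tpoly \<Rightarrow> tpoly" where
  "const_in_last h = (\<lambda>u. if u \<noteq> [] \<and> last u = 0 then h (butlast u) else Infty)"

lemma const_in_last_snoc [simp]:
  "const_in_last h (w @ [k]) = (if k = 0 then h w else Infty)"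
  by (simp add: const_in_last_def)

lemma is_tpoly_const_in_last:
  assumes "is_tpoly n h"
  shows "is_tpoly (Suc n) (const_in_last h)"
proof -
  have *: "\<exists>w. u = w @ [0] \<and> h w \<noteq> Infty" if "const_in_last h u \<noteq> Infty" for u
    using that by (cases u rule: rev_cases) (auto simp: const_in_last_def split: if_splits)
  then have "{u. const_in_last h u \<noteq> Infty} \<subseteq> (\<lambda>w. w @ [0]) ` {w. h w \<noteq> Infty}"
    by blast
  then show ?thesis using assms * unfolding is_tpoly_def
    by (metis (no_types, lifting) finite_imageI finite_subset length_append_singleton)
qed

lemma le_tmul_subst_last_iff:
  assumes "is_tpoly n f"
  shows "c \<le> tmul x (subst_last a f w) \<longleftrightarrow> (\<forall>k. c \<le> tmul x (tmul (f (w @ [k])) (tpow a k)))"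
  unfolding subst_last_def tmul_sum_right[OF finite_last_coords[OF assms]]
    le_sum_trop_iff[OF finite_last_coords[OF assms]] Ball_def mem_Collect_eq
proof (intro iff_allI)
  fix k
  show "(f (w @ [k]) \<noteq> Infty \<longrightarrow> c \<le> tmul x (tmul (f (w @ [k])) (tpow a k))) \<longleftrightarrow>
      c \<le> tmul x (tmul (f (w @ [k])) (tpow a k))"
    by (cases "f (w @ [k]) = Infty") simp_all
qed

lemma is_tpoly_pmul:
  assumes "is_tpoly n f" "is_tpoly n g"
  shows "is_tpoly n (pmul f g)"
proof -
  have *: "\<exists>u v. length u = length w \<and> map2 (+) u v = w \<and> f u \<noteq> Infty \<and> g v \<noteq> Infty"
    if "pmul f g w \<noteq> Infty" for w
    using that le_pmul_iff[OF assms, of Infty w] by auto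
  then have "{w. pmul f g w \<noteq> Infty} \<subseteq>
      (\<lambda>(u, v). map2 (+) u v) ` ({u. f u \<noteq> Infty} \<times> {u. g u \<noteq> Infty})"
    by (force simp: image_iff)
  then have "finite {w. pmul f g w \<noteq> Infty}"
    using assms by (auto simp: is_tpoly_def intro: finite_subset)
  with * assms show ?thesis unfolding is_tpoly_def by metis
qed

lemma subst_last_pmul_const_in_last:
  assumes "is_tpoly n h" "is_tpoly (Suc n) f"
  shows "subst_last a (pmul (const_in_last h) f) = pmul h (subst_last a f)"
proof (intro ext eq_by_lower_bounds)
  fix w c
  note h' = is_tpoly_const_in_last[OF assms(1)]
  \<comment> \<open>Here \<open>t\<close> stands for the power of \<open>a\<close> attached to the
    exponent \<open>k\<close>.\<close>
  have le_tmul_iff: "c \<le> tmul (pmul (const_in_last h) f (w @ [k])) t \<longleftrightarrow>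
      (\<forall>u v. length u = length w \<and> length v = length w \<and> map2 (+) u v = w \<longrightarrow>
         c \<le> tmul (h u) (tmul (f (v @ [k])) t))" for k t
  proof -
    have "c \<le> tmul (pmul (const_in_last h) f (w @ [k])) t \<longleftrightarrow>
      (\<forall>u v. length u = Suc (length w) \<and> length v = Suc (length w) \<and> map2 (+) u v = w @ [k] \<longrightarrow>
         c \<le> tmul t (tmul (const_in_last h u) (f v)))"
      unfolding tmul_commute[of "pmul _ _ _" t] le_tmul_pmul_iff[OF h' assms(2)] by simp
    also have "\<dots> \<longleftrightarrow> (\<forall>u v i j. length u = length w \<and> length v = length w \<and>
        map2 (+) u v = w \<and> i + j = k \<longrightarrow>
         c \<le> tmul t (tmul (const_in_last h (u @ [i])) (f (v @ [j]))))"
      (is "?l \<longleftrightarrow> ?r")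
    proof
      assume l: ?l
      show ?r
      proof (intro allI impI)
        fix u v i j
        assume "length u = length w \<and> length v = length w \<and> map2 (+) u v = w \<and> i + j = k"
        then show "c \<le> tmul t (tmul (const_in_last h (u @ [i])) (f (v @ [j])))"
          by (intro l[rule_format]) simp
      qed
    next
      assume r: ?r
      show ?l
      proof (intro allI impI)
        fix u v
        assume uv: "length u = Suc (length w) \<and> length v = Suc (length w) \<and> map2 (+) u v = w @ [k]"
        then obtain u' i v' j where "u = u' @ [i]" "v = v' @ [j]"
          by (metis length_Suc_conv_rev)
        moreover from this uv have "length u' = length w" "length v' = length w" by auto
        ultimately show "c \<le> tmul t (tmul (const_in_last h u) (f v))"
          using uv r[rule_format, of u' v' i j] by simp
      qed
    qed
    \<comment> \<open>The factor \<open>const_in_last h\<close> is finite only at last exponent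
      \<open>i = 0\<close>, which leaves \<open>j = k\<close>.\<close>
    also have "\<dots> \<longleftrightarrow> (\<forall>u v. length u = length w \<and> length v = length w \<and> map2 (+) u v = w \<longrightarrow>
         c \<le> tmul (h u) (tmul (f (v @ [k])) t))"
    proof (intro iff_allI)
      fix u v
      have "tmul (h u) (tmul (f (v @ [k])) t) = tmul t (tmul (h u) (f (v @ [k])))"
        by (metis tmul_assoc tmul_commute)
      then show "(\<forall>i j. length u = length w \<and> length v = length w \<and> map2 (+) u v = w \<and> i + j = k \<longrightarrow>
            c \<le> tmul t (tmul (const_in_last h (u @ [i])) (f (v @ [j])))) \<longleftrightarrow>
          (length u = length w \<and> length v = length w \<and> map2 (+) u v = w \<longrightarrow>
            c \<le> tmul (h u) (tmul (f (v @ [k])) t))"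
        by simp
    qed
    finally show ?thesis .
  qed
  show "c \<le> subst_last a (pmul (const_in_last h) f) w \<longleftrightarrow> c \<le> pmul h (subst_last a f) w"
    unfolding le_subst_last_iff[OF is_tpoly_pmul[OF h' assms(2)]] le_tmul_iff
      le_pmul_iff[OF assms(1) is_tpoly_subst_last[OF assms(2)]] le_tmul_subst_last_iff[OF assms(2)]
    by blast
qed

lemma tideal_subst_last:
  assumes "tideal (Suc n) I"
  shows "tideal n (subst_last a ` I)"
proof -
  note P = tideal_is_tpoly[OF assms]
  have "(\<lambda>_. Infty) \<in> I" using assms by (simp add: tideal_def)
  moreover have "subst_last a (\<lambda>_. Infty) = (\<lambda>_. Infty)" by (auto intro: subst_last_eq_Infty)
  ultimately have "(\<lambda>_. Infty) \<in> subst_last a ` I" by (metis image_eqI)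
  moreover have "padd (subst_last a f) (subst_last a g) \<in> subst_last a ` I" if "f \<in> I" "g \<in> I" for f g
    using assms that subst_last_padd[OF P P, OF that, of a] by (metis image_eqI tideal_def)
  moreover have "pmul h (subst_last a f) \<in> subst_last a ` I" if "f \<in> I" "is_tpoly n h" for f h
    using assms that subst_last_pmul_const_in_last[OF that(2) P, OF that(1), of a]
      is_tpoly_const_in_last[OF that(2)] by (metis image_eqI tideal_def)
  ultimately show ?thesis
    using P is_tpoly_subst_last by (auto simp: tideal_def)
qed

text \<open>It suffices to control one coordinate \<open>v\<close> at a time, because the resulting polynomials
  can be added up.\<close>

lemma tropical_idealI:
  assumes "tideal n I"
    and elim: "\<And>f g u v. \<lbrakk>f \<in> I; g \<in> I; f u = g u; f u \<noteq> Infty; f v < g v\<rbrakk> \<Longrightarrow>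
      \<exists>h\<in>I. h u = Infty \<and> (\<forall>x. min (f x) (g x) \<le> h x) \<and> h v = f v"
  shows "tropical_ideal n I"
  unfolding tropical_ideal_def
proof (intro conjI ballI allI impI; (elim conjE)?)
  show "tideal n I" by fact
  fix f g u assume f: "f \<in> I" and g: "g \<in> I" and u: "f u = g u" "f u \<noteq> Infty"
  \<comment> \<open>The hypothesis treats only \<open>f v < g v\<close>; the other case follows by
    exchanging \<open>f\<close> and \<open>g\<close>.\<close>
  have elim': "\<exists>h\<in>I. h u = Infty \<and> (\<forall>x. min (f x) (g x) \<le> h x) \<and> h v = min (f v) (g v)"
    if "f v \<noteq> g v" for v
  proof (cases "f v < g v")
    case True
    then show ?thesis using elim[OF f g u True] by (simp add: min.absorb1)
  next
    case False
    with that have "g v < f v" by simp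
    moreover from this have "min (g v) (f v) = g v" by simp
    moreover have "g u \<noteq> Infty" using u by simp
    ultimately show ?thesis
      using elim[OF g f u(1)[symmetric], of v]
      by (simp only: min.commute[of "f _"] simp_thms)
  qed
  have sum: "\<exists>h\<in>I. h u = Infty \<and> (\<forall>x. min (f x) (g x) \<le> h x) \<and> (\<forall>v\<in>V. h v = min (f v) (g v))"
    if "finite V" "V \<subseteq> {v. f v \<noteq> g v}" for V
    using that
  proof induction
    case empty
    then show ?case using assms(1) by (intro bexI[of _ "\<lambda>_. Infty"]) (auto simp: tideal_def)
  next
    case (insert v V)
    then obtain h where h: "h \<in> I" "h u = Infty" "\<forall>x. min (f x) (g x) \<le> h x"
      "\<forall>v\<in>V. h v = min (f v) (g v)" by auto
    obtain h' where h': "h' \<in> I" "h' u = Infty" "\<forall>x. min (f x) (g x) \<le> h' x"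
      "h' v = min (f v) (g v)" using elim'[of v] insert.prems by auto
    have "padd h h' \<in> I" using assms(1) h h' by (simp add: tideal_def)
    moreover have "padd h h' u = Infty" using h h' by (simp add: padd_def plus_trop_def)
    moreover have "min (f x) (g x) \<le> padd h h' x" for x
      using h(3) h'(3) unfolding padd_def le_plus_trop_iff by blast
    \<comment> \<open>At each such \<open>x\<close> one summand attains the minimum and the other
      does not fall below it.\<close>
    moreover have "padd h h' x = min (f x) (g x)" if "x \<in> insert v V" for x
      using that h(3,4) h'(3,4) unfolding padd_def plus_trop_def
      by (metis insertE min.absorb1 min.absorb2)
    ultimately show ?case by blast
  qed
  have "finite {v. f v \<noteq> g v}"
  proof (rule finite_subset)
    show "{v. f v \<noteq> g v} \<subseteq> {v. f v \<noteq> Infty} \<union> {v. g v \<noteq> Infty}" by auto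
    show "finite ({v. f v \<noteq> Infty} \<union> {v. g v \<noteq> Infty})"
      using tideal_is_tpoly[OF assms(1)] f g by (simp add: is_tpoly_def)
  qed
  from sum[OF this order_refl] show "\<exists>h\<in>I. h u = Infty \<and>
      (\<forall>v. h v \<ge> min (f v) (g v) \<and> (f v \<noteq> g v \<longrightarrow> h v = min (f v) (g v)))"
    by blast
qed

section \<open>Elimination for a finite value of the last variable\<close>

text \<open>Taking the least exponent that attains the minimum makes all smaller ones strict, which
  is the source of the echelon form.\<close>

lemma subst_last_first_attained:
  assumes "is_tpoly n f" "subst_last a f w \<noteq> Infty"
  shows "\<exists>k. f (w @ [k]) \<noteq> Infty \<and> tmul (f (w @ [k])) (tpow a k) = subst_last a f w \<and>
    (\<forall>j<k. subst_last a f w < tmul (f (w @ [j])) (tpow a j))"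
proof -
  let ?Q = "\<lambda>k. tmul (f (w @ [k])) (tpow a k) = subst_last a f w"
  have "\<exists>k. ?Q k" using subst_last_attained[OF assms] by metis
  then have Q: "?Q (LEAST k. ?Q k)" by (rule LeastI_ex)
  moreover have "f (w @ [LEAST k. ?Q k]) \<noteq> Infty" using Q assms(2) by auto
  moreover have "subst_last a f w < tmul (f (w @ [j])) (tpow a j)" if "j < (LEAST k. ?Q k)" for j
    using not_less_Least[OF that] subst_last_le[OF assms(1), of a w j] by simp
  ultimately show ?thesis by blast
qed

text \<open>The multiple of \<open>f\<close> by the \<open>i\<close>-th power of \<open>x / a\<close>, where \<open>x\<close> is the last
  variable: it has the same image under the substitution \<open>x = a\<close>.\<close>

definition last_shift :: "nat \<Rightarrow> real \<Rightarrow> nat \<Rightarrow> tpoly \<Rightarrow> tpoly" where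
  "last_shift n a i f = pmul (tmonom (Fin (- real i * a)) (replicate n 0 @ [i])) f"

lemma last_shift_in_tideal:
  assumes "tideal (Suc n) I" "f \<in> I"
  shows "last_shift n a i f \<in> I"
  using assms is_tpoly_tmonom[of "replicate n 0 @ [i]"] by (simp add: last_shift_def tideal_def)

text \<open>After weighting by powers of \<open>a\<close>, the coefficient of the shift cancels and
  only a reindexing by \<open>i\<close> remains.\<close>

lemma last_shift_snoc:
  assumes "is_tpoly (Suc n) f"
  shows "tmul (last_shift n a i f (w @ [k])) (tpow (Fin a) k) =
    (if i \<le> k then tmul (f (w @ [k - i])) (tpow (Fin a) (k - i)) else Infty)"
proof (cases "i \<le> k \<and> f (w @ [k - i]) \<noteq> Infty")
  case True
  then obtain y where "f (w @ [k - i]) = Fin y" by (cases "f (w @ [k - i])") auto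
  with True show ?thesis
    by (simp add: last_shift_def pmul_last_power[OF assms] of_nat_diff algebra_simps)
qed (auto simp: last_shift_def pmul_last_power[OF assms])

lemma eliminate_subst_last_Fin:
  fixes a :: real
  assumes I: "tropical_ideal (Suc n) I" and f: "f \<in> I" and g: "g \<in> I"
  defines "F \<equiv> subst_last (Fin a) f" and "G \<equiv> subst_last (Fin a) g"
  assumes u: "F u = G u" "F u \<noteq> Infty" and v: "F v < G v"
  shows "\<exists>h\<in>I. subst_last (Fin a) h u = Infty \<and>
    (\<forall>x. min (F x) (G x) \<le> subst_last (Fin a) h x) \<and> subst_last (Fin a) h v = F v"
proof -
  have tideal: "tideal (Suc n) I" using I by (simp add: tropical_ideal_def)
  note P = tideal_is_tpoly[OF tideal]
  note Pf = P[OF f] and Pg = P[OF g]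
  have Fv: "F v \<noteq> Infty" using v by auto
  obtain r where r: "tmul (f (v @ [r])) (tpow (Fin a) r) = F v"
    "\<And>j. j < r \<Longrightarrow> F v < tmul (f (v @ [j])) (tpow (Fin a) j)"
    using subst_last_first_attained[OF Pf] Fv unfolding F_def by blast
  obtain s where s: "g (u @ [s]) \<noteq> Infty" "tmul (g (u @ [s])) (tpow (Fin a) s) = G u"
    "\<And>j. j < s \<Longrightarrow> G u < tmul (g (u @ [j])) (tpow (Fin a) j)"
    using subst_last_first_attained[OF Pg] u unfolding G_def by metis
  have "finite ({k. f (u @ [k]) \<noteq> Infty} \<union> {k. g (u @ [k]) \<noteq> Infty})"
    using finite_last_coords Pf Pg by blast
  then obtain D where "\<forall>k\<in>{k. f (u @ [k]) \<noteq> Infty} \<union> {k. g (u @ [k]) \<noteq> Infty}. k \<le> D"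
    unfolding finite_nat_set_iff_bounded_le by blast
  then have D: "D < k \<Longrightarrow> f (u @ [k]) = Infty" "D < k \<Longrightarrow> g (u @ [k]) = Infty" for k
    by force+
  define N where "N = Suc D"
  \<comment> \<open>Degrees over \<open>u\<close> are at most \<open>D\<close> and shifts at most
    \<open>D\<close>, so nothing lies over \<open>u\<close> beyond \<open>2 * D\<close>. Building
    this into \<open>L\<close> leaves only finitely many coordinates to eliminate.\<close>
  define L where "L = {h \<in> I. \<forall>x\<in>(\<lambda>k. u @ [k]) ` {2 * D<..} \<union> {[]}. h x = Infty}"
  \<comment> \<open>The factor undoes the weight of the last exponent: \<open>B \<le> h\<close> away
    from \<open>[]\<close> says that the specialisation of \<open>h\<close> is at least
    \<open>min (F x) (G x)\<close> everywhere, and equality at one monomial over \<open>x\<close>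
    fixes its value at \<open>x\<close>.\<close>
  define B where "B x = (if x = [] then Infty else
      tmul (min (F (butlast x)) (G (butlast x))) (Fin (- real (last x) * a)))" for x
  have B_snoc: "tmul (B (x @ [k])) (tpow (Fin a) k) = min (F x) (G x)" for x k
    by (simp add: B_def tmul_assoc)
  have B_le: "B (x @ [k]) \<le> y \<longleftrightarrow> min (F x) (G x) \<le> tmul y (tpow (Fin a) k)" for x k y
    by (simp add: B_snoc[of x k, symmetric])
  have B_less: "B (x @ [k]) < y \<longleftrightarrow> min (F x) (G x) < tmul y (tpow (Fin a) k)" for x k y
    by (simp add: B_snoc[of x k, symmetric])
  have B_eq: "y = B (x @ [k]) \<longleftrightarrow> tmul y (tpow (Fin a) k) = min (F x) (G x)" for x k y
    by (simp add: B_snoc[of x k, symmetric])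
  have minv: "min (F v) (G v) = F v" and minu: "min (F u) (G u) = F u"
    using u v by (auto simp: min_def)
  \<comment> \<open>The \<open>N\<close> shifts of \<open>f\<close> come first, then those of
    \<open>g\<close>; the pivots in \<open>l\<close> move along with the shifts.\<close>
  define w where "w i = (if i < N then last_shift n a i f else last_shift n a (i - N) g)" for i
  define l where "l i = (if i < N then v @ [r + i] else u @ [s + (i - N)])" for i
  have w_le: "min (F x) (G x) \<le> tmul (w i (x @ [k])) (tpow (Fin a) k)" for i x k
  proof -
    have "F x \<le> tmul (f (x @ [j])) (tpow (Fin a) j)" "G x \<le> tmul (g (x @ [j])) (tpow (Fin a) j)" for j
      unfolding F_def G_def using subst_last_le Pf Pg by blast+
    then show ?thesis
      unfolding w_def by (auto simp: last_shift_snoc[OF Pf] last_shift_snoc[OF Pg] min_le_iff_disj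
          simp del: tpow_Fin)
  qed
  have "\<exists>h\<in>L. (\<forall>x\<in>(\<lambda>k. u @ [k]) ` {..2 * D}. h x = Infty) \<and> (\<forall>x. B x \<le> h x) \<and>
      (\<exists>j\<in>{..<2 * N}. h (l j) = B (l j))"
  proof (rule eliminate_from_echelon_family[where w = w])
    show "elim_closed L"
      unfolding L_def by (intro elim_closed_vanishing elim_closed_tropical_ideal[OF I])
    show "card ((\<lambda>k. u @ [k]) ` {..2 * D}) < card {..<2 * N}"
      using card_image_le[of "{..2 * D}" "\<lambda>k. u @ [k]"] by (simp add: N_def)
    fix j assume j: "j \<in> {..<2 * N}"
    have wI: "w j \<in> I"
      unfolding w_def using last_shift_in_tideal[OF tideal] f g by simp
    have w_Nil: "w j [] = Infty" using P[OF wI] by (auto simp: is_tpoly_def)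
    moreover have "w j (u @ [k]) = Infty" if "2 * D < k" for k
      using that j
      by (auto simp: w_def last_shift_def pmul_last_power[OF Pf] pmul_last_power[OF Pg] N_def
          intro!: D)
    ultimately show "w j \<in> L" using wI by (auto simp: L_def)
    show "B x \<le> w j x" for x
      using w_Nil w_le B_le by (cases x rule: rev_cases) auto
    show "w j (l j) = B (l j)"
      using r(1) s(2) unfolding w_def l_def
      by (auto simp: B_eq last_shift_snoc[OF Pf] last_shift_snoc[OF Pg] minu minv u simp del: tpow_Fin)
    show "B (l j) \<noteq> Infty"
      using u(2) Fv minu minv by (auto simp: l_def B_def)
    fix i assume i: "i \<in> {..<2 * N}" and "i < j"
    have Gv: "F v < tmul (g (v @ [k])) (tpow (Fin a) k)" for k
      using v subst_last_le[OF Pg] unfolding G_def by (rule less_le_trans)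
    \<comment> \<open>Within one block, the larger shift \<open>j\<close> reads the unshifted
      polynomial below \<open>r\<close> or \<open>s\<close>, where the minimum is not yet attained,
      or finds no monomial. For \<open>i\<close> in the block of \<open>f\<close> and
      \<open>j\<close> in that of \<open>g\<close>, \<open>Gv\<close> applies; the reverse order
      cannot occur.\<close>
    show "B (l i) < w j (l i)"
      using \<open>i < j\<close> j i Gv r(2) s(3) u(2) Fv unfolding w_def l_def
      by (auto simp: B_less last_shift_snoc[OF Pf] last_shift_snoc[OF Pg] minu minv u simp del: tpow_Fin)
  qed auto
  then obtain h j where h: "h \<in> L" "\<And>k. k \<le> 2 * D \<Longrightarrow> h (u @ [k]) = Infty" "\<And>x. B x \<le> h x"
    and j: "j < 2 * N" "h (l j) = B (l j)"
    by auto
  have "h \<in> I" using h(1) by (simp add: L_def)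
  note Ph = P[OF this]
  have hu: "h (u @ [k]) = Infty" for k
    using h(1,2) by (cases "k \<le> 2 * D") (auto simp: L_def)
  have ge: "min (F x) (G x) \<le> subst_last (Fin a) h x" for x
    unfolding le_subst_last_iff[OF Ph] using h(3) B_le by blast
  \<comment> \<open>A pivot of the second block lies over \<open>u\<close>, where \<open>h\<close>
    is absent although \<open>B\<close> is finite.\<close>
  have "j < N"
  proof (rule ccontr)
    assume "\<not> j < N"
    then have "B (u @ [s + (j - N)]) = Infty" using j(2) hu by (simp add: l_def)
    then show False using u(2) minu by (simp add: B_def)
  qed
  then have "tmul (h (v @ [r + j])) (tpow (Fin a) (r + j)) = F v"
    using j(2) B_eq minv by (simp add: l_def)
  then have "subst_last (Fin a) h v \<le> F v" using subst_last_le[OF Ph] by metis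
  with ge[of v] minv have "subst_last (Fin a) h v = F v" by simp
  then show ?thesis
    using \<open>h \<in> I\<close> hu ge subst_last_eq_Infty by blast
qed

theorem theorem3p3:
  fixes n :: nat and I :: "tpoly set" and a :: trop
  assumes "n \<ge> 1" and "tropical_ideal n I"
  shows "tropical_ideal (n - 1) (subst_last a ` I)"
proof -
  obtain m where m: "n = Suc m" using assms(1) by (cases n) auto
  have I: "tropical_ideal (Suc m) I" using assms(2) m by simp
  then have tideal: "tideal (Suc m) I" by (simp add: tropical_ideal_def)
  have "tropical_ideal m (subst_last a ` I)"
  proof (rule tropical_idealI)
    show "tideal m (subst_last a ` I)" using tideal by (rule tideal_subst_last)
    fix F G u v
    assume "F \<in> subst_last a ` I" "G \<in> subst_last a ` I"
      and u: "F u = G u" "F u \<noteq> Infty" and v: "F v < G v"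
    then obtain f g where f: "f \<in> I" "F = subst_last a f" and g: "g \<in> I" "G = subst_last a g"
      by auto
    have "\<exists>h\<in>I. subst_last a h u = Infty \<and> (\<forall>x. min (F x) (G x) \<le> subst_last a h x) \<and>
        subst_last a h v = F v"
    proof (cases a)
      case (Fin x)
      then show ?thesis using eliminate_subst_last_Fin[OF I f(1) g(1)] u v f g by auto
    next
      case Infty
      \<comment> \<open>Only the monomial \<open>u @ [0]\<close> lies over \<open>u\<close> after
        this substitution, so a single elimination in \<open>I\<close> suffices.\<close>
      note eq = subst_last_Infty[OF tideal_is_tpoly[OF tideal]]
      have "f (u @ [0]) = g (u @ [0])" "f (u @ [0]) \<noteq> Infty"
        using u f g Infty eq by auto
      then obtain h where h: "h \<in> I" "h (u @ [0]) = Infty"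
        "\<And>v. h v \<ge> min (f v) (g v)" "\<And>v. f v \<noteq> g v \<Longrightarrow> h v = min (f v) (g v)"
        using elim_closedE[OF elim_closed_tropical_ideal[OF I] f(1) g(1), of "u @ [0]"] by blast
      moreover have "h (v @ [0]) = f (v @ [0])"
        using v h(4)[of "v @ [0]"] by (simp add: f g Infty eq min.absorb1)
      ultimately show ?thesis
        by (intro bexI[of _ h]) (simp_all add: f g Infty eq)
    qed
    then show "\<exists>h\<in>subst_last a ` I. h u = Infty \<and> (\<forall>x. min (F x) (G x) \<le> h x) \<and> h v = F v"
      by blast
  qed
  with m show ?thesis by simp
qed

end
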